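(* Let $\Gamma\subset\mathbb{R}^n$ be the attractor of an iterated function system $\{s_1,\dots,s_M\}$ of contracting similarities satisfying the open set condition, and let $\mu,\mu'$ be invariant measures on $\Gamma$ with weights $(p_1,\dots,p_M)$ and $(p_1',\dots,p_M')$ respectively. Suppose that $\Gamma$ is disjoint, i.e. $\min_{m\ne m'}\mathrm{dist}(s_m(\Gamma),s_{m'}(\Gamma))>0$. Then the singular double integral $I_{\Gamma,\Gamma}[\Phi_t]=\int_\Gamma\int_\Gamma\Phi_t(x,y)\,d\mu'(y)\,d\mu(x)$ converges for $0\le t<t_*$, where $t_*$ is the unique positive solution of $\sum_{m=1}^Mp_mp_m'\rho_m^{-t_*}=1$, and it can be represented in terms of regular integrals as $$I_{\Gamma,\Gamma}[\Phi_t]=\begin{cases}\Big(1-\sum_{m=1}^Mp_mp_m'\Big)^{-1}\sum_{m=1}^M\Big(p_mp_m'\,\mu(\Gamma)\mu'(\Gamma)\log\rho_m+\sum_{m'=1,\,m'\ne m}^MI_{\Gamma_m,\Gamma_{m'}}[\Phi_t]\Big),&t=0,\\[2mm]\Big(1-\sum_{m=1}^Mp_mp_m'\rho_m^{-t}\Big)^{-1}\sum_{m=1}^M\sum_{m'=1,\,m'\ne m}^MI_{\Gamma_m,\Gamma_{m'}}[\Phi_t],&t\in(0,t_* ),\end{cases}$$ where $\Gamma_m:=s_m(\Gamma)$ and $I_{\Gamma_m,\Gamma_{m'}}[f]:=\int_{\Gamma_m}\int_{\Gamma_{m'}}f(x,y)\,d\mu'(y)\,d\mu(x)$.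
   Context: IFS: a collection $\{s_1,\dots,s_M\}$, $M\ge2$, of maps $s_m:\mathbb{R}^n\to\mathbb{R}^n$, $s_m(x)=\rho_mA_mx+\delta_m$, with $\rho_m\in(0,1)$, $A_m$ an orthogonal $n\times n$ matrix, $\delta_m\in\mathbb{R}^n$. Its attractor $\Gamma$ is the unique non-empty compact set with $\Gamma=\bigcup_{m=1}^Ms_m(\Gamma)$. Open set condition: there is a non-empty bounded open set $O\subset\mathbb{R}^n$ with $\bigcup_ms_m(O)\subset O$ and $s_m(O)\cap s_{m'}(O)=\emptyset$ for $m\ne m'$. Invariant measure with weights $(p_1,\dots,p_M)$, where $p_m\in(0,1)$ and $\sum_mp_m=1$: a non-zero finite Borel regular measure $\mu$ supported on $\Gamma$ such that $\mu(A)=\sum_{m=1}^Mp_m\mu(s_m^{-1}(A))$ for every measurable $A\subset\mathbb{R}^n$ (unique up to normalisation). For $t\ge0$ and $x\ne y$: $\Phi_0(x,y):=\log|x-y|$ and $\Phi_t(x,y):=|x-y|^{-t}$ for $t>0$. *)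

theory Defs
  imports "HOL-Analysis.Analysis"
begin

definition similarity_ifs ::
  "nat \<Rightarrow> (nat \<Rightarrow> real) \<Rightarrow> (nat \<Rightarrow> real^'n^'n) \<Rightarrow> (nat \<Rightarrow> real^'n) \<Rightarrow> (nat \<Rightarrow> real^'n \<Rightarrow> real^'n) \<Rightarrow> bool"
  where
  "similarity_ifs M \<rho> A \<delta> s \<longleftrightarrow>
     2 \<le> M \<and>
     (\<forall>m\<in>{1..M}. 0 < \<rho> m \<and> \<rho> m < 1 \<and> orthogonal_matrix (A m) \<and>
        (\<forall>x. s m x = \<rho> m *\<^sub>R (A m *v x) + \<delta> m))"

definition is_attractor :: "nat \<Rightarrow> (nat \<Rightarrow> real^'n \<Rightarrow> real^'n) \<Rightarrow> (real^'n) set \<Rightarrow> bool" where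
  "is_attractor M s \<Gamma> \<longleftrightarrow> \<Gamma> \<noteq> {} \<and> compact \<Gamma> \<and> \<Gamma> = (\<Union>m\<in>{1..M}. s m ` \<Gamma>)"

definition open_set_condition :: "nat \<Rightarrow> (nat \<Rightarrow> real^'n \<Rightarrow> real^'n) \<Rightarrow> bool" where
  "open_set_condition M s \<longleftrightarrow>
     (\<exists>U. U \<noteq> {} \<and> bounded U \<and> open U \<and> (\<Union>m\<in>{1..M}. s m ` U) \<subseteq> U \<and>
        (\<forall>m\<in>{1..M}. \<forall>m'\<in>{1..M}. m \<noteq> m' \<longrightarrow> s m ` U \<inter> s m' ` U = {}))"

definition disjoint_attractor :: "nat \<Rightarrow> (nat \<Rightarrow> real^'n \<Rightarrow> real^'n) \<Rightarrow> (real^'n) set \<Rightarrow> bool" where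
  "disjoint_attractor M s \<Gamma> \<longleftrightarrow>
     0 < Min {setdist (s m ` \<Gamma>) (s m' ` \<Gamma>) | m m'. m \<in> {1..M} \<and> m' \<in> {1..M} \<and> m \<noteq> m'}"

definition ifs_weights :: "nat \<Rightarrow> (nat \<Rightarrow> real) \<Rightarrow> bool" where
  "ifs_weights M p \<longleftrightarrow> (\<forall>m\<in>{1..M}. 0 < p m \<and> p m < 1) \<and> (\<Sum>m\<in>{1..M}. p m) = 1"

text \<open>The measure lives on the Borel sigma-algebra of the whole space. Borel regularity has no
  separate clause: the outer measure induced by a measure on the Borel sets is always Borel
  regular, and a finite Borel measure on Euclidean space is inner and outer regular.\<close>

definition invariant_measure ::
  "nat \<Rightarrow> (nat \<Rightarrow> real^'n \<Rightarrow> real^'n) \<Rightarrow> (nat \<Rightarrow> real) \<Rightarrow> (real^'n) set \<Rightarrow> (real^'n) measure \<Rightarrow> bool"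
  where
  "invariant_measure M s p \<Gamma> \<mu> \<longleftrightarrow>
     sets \<mu> = sets borel \<and> finite_measure \<mu> \<and>
     measure \<mu> UNIV \<noteq> 0 \<and> measure \<mu> (- \<Gamma>) = 0 \<and>
     (\<forall>B\<in>sets borel. measure \<mu> B = (\<Sum>m\<in>{1..M}. p m * measure \<mu> (s m -` B)))"

text \<open>The values at \<open>x = y\<close> (namely \<open>0\<close>) are an artefact of totality: the kernel is only
  meaningful off the diagonal, where \<open>converges_on\<close> below requires almost every point to lie.\<close>

definition Phi :: "real \<Rightarrow> real^'n \<Rightarrow> real^'n \<Rightarrow> real" where
  "Phi t x y = (if t = 0 then ln (norm (x - y)) else norm (x - y) powr (- t))"

definition double_integral ::
  "(real^'n) measure \<Rightarrow> (real^'n) measure \<Rightarrow> (real^'n) set \<Rightarrow> (real^'n) set \<Rightarrow>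
     (real^'n \<Rightarrow> real^'n \<Rightarrow> real) \<Rightarrow> real" where
  "double_integral \<mu> \<mu>' S T f = (LINT x:S|\<mu>. (LINT y:T|\<mu>'. f x y))"

text \<open>Convergence of a double integral whose kernel \<open>f\<close> is singular on the diagonal: \<open>f\<close> is
  defined almost everywhere on \<open>S \<times> T\<close> and absolutely integrable there with respect to the
  product measure.\<close>

definition converges_on ::
  "(real^'n) measure \<Rightarrow> (real^'n) measure \<Rightarrow> (real^'n) set \<Rightarrow> (real^'n) set \<Rightarrow>
     (real^'n \<Rightarrow> real^'n \<Rightarrow> real) \<Rightarrow> bool" where
  "converges_on \<mu> \<mu>' S T f \<longleftrightarrow>
     (AE z in \<mu> \<Otimes>\<^sub>M \<mu>'. z \<in> S \<times> T \<longrightarrow> fst z \<noteq> snd z) \<and>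
     set_integrable (\<mu> \<Otimes>\<^sub>M \<mu>') (S \<times> T) (\<lambda>(x, y). f x y)"

end

theory Submission
  imports Defs begin

text \<open>
  Let \<open>\<nu> = \<mu> \<Otimes> \<mu>'\<close>. Because the pieces \<open>\<Gamma>\<^sub>m = s\<^sub>m \<Gamma>\<close> are disjoint, invariance says that \<open>\<mu>\<close>
  restricted to \<open>\<Gamma>\<^sub>m\<close> is exactly \<open>p\<^sub>m\<close> times the image of \<open>\<mu>\<close> under \<open>s\<^sub>m\<close>
  (\<open>measure_Int_cylinder\<close>), and similarly for \<open>\<nu>\<close> on products of pieces (\<open>nu_cylinder\<close>). Splitting
  \<open>\<Gamma> \<times> \<Gamma>\<close> into such products and using that \<open>s\<^sub>m\<close> scales distances by \<open>\<rho>\<^sub>m\<close>, one gets for every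
  integrable kernel that depends on the distance \<open>r\<close> alone
  \<open>\<integral> h(r) d\<nu> = (\<Sum>m. p\<^sub>m p'\<^sub>m \<integral> h(\<rho>\<^sub>m r) d\<nu>) + C(h)\<close>,
  where \<open>C(h)\<close> collects the pairs of distinct pieces, on which \<open>r\<close> stays above the gap
  (\<open>radial_self_similarity\<close>). Different choices of \<open>h\<close> in this identity give
  the two formulas and the convergence.

  For \<open>h(r) = r\<^sup>-\<^sup>t\<close> it reads \<open>I = q I + C\<close> with \<open>q = \<Sum>m. p\<^sub>m p'\<^sub>m \<rho>\<^sub>m\<^sup>-\<^sup>t\<close>, and for \<open>h = ln\<close> it
  reads \<open>I = q I + (\<Sum>m. p\<^sub>m p'\<^sub>m ln \<rho>\<^sub>m) \<nu>(\<Gamma> \<times> \<Gamma>) + C\<close> with \<open>t = 0\<close> in \<open>q\<close>; solving for \<open>I\<close> gives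
  the two formulas. The sum \<open>q\<close> is strictly increasing in \<open>t\<close>, is below \<open>1\<close> at \<open>t = 0\<close> and eventually
  exceeds \<open>1\<close>, so that \<open>q < 1\<close> holds precisely for \<open>t\<close> below the critical exponent.

  Solving for \<open>I\<close> is legitimate only once \<open>I\<close> is known to be finite. The diagonal is \<open>\<nu>\<close>-null by the
  identity for the indicator of \<open>r = 0\<close>. The truncated kernel \<open>(max r \<epsilon>)\<^sup>-\<^sup>t\<close> is bounded, hence
  integrable, and the identity turns into the inequality \<open>I \<le> q I + C\<close> with a constant \<open>C\<close> independent of
  \<open>\<epsilon>\<close>; the resulting uniform bound passes to the limit \<open>\<epsilon> \<rightarrow> 0\<close> by monotone convergence
  (\<open>truncated_energy_bound\<close>, \<open>integrable_riesz\<close>). The logarithm is dominated by \<open>r\<^sup>-\<^sup>t\<close> for a small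
  \<open>t > 0\<close>.
\<close>

section \<open>Self-similar measures on separated attractors\<close>

lemma solve_affine: "x = q * x + c \<Longrightarrow> q < 1 \<Longrightarrow> x = inverse (1 - q) * c" for x q c :: real
  by (simp add: field_simps)

lemma solve_affine_le: "x \<le> q * x + c \<Longrightarrow> q < 1 \<Longrightarrow> x \<le> c / (1 - q)" for x q c :: real
  by (simp add: field_simps)

text \<open>
  What drives the argument is that similarities scale distances; it is carried out in separable
  metric spaces, where the distance is measurable for the product of the Borel \<open>\<sigma>\<close>-algebras. The
  number \<open>d\<close> is a lower bound for the distances between different pieces.
\<close>

locale separated_similarities =
  fixes M :: nat
    and \<rho> :: "nat \<Rightarrow> real"
    and s :: "nat \<Rightarrow> 'a::{metric_space, second_countable_topology} \<Rightarrow> 'a"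
    and \<Gamma> :: "'a set"
    and d :: real
  assumes ratio: "m \<in> {1..M} \<Longrightarrow> 0 < \<rho> m \<and> \<rho> m < 1"
    and dist_s: "m \<in> {1..M} \<Longrightarrow> dist (s m x) (s m y) = \<rho> m * dist x y"
    and compact_attractor: "compact \<Gamma>"
    and attractor: "\<Gamma> = (\<Union>m\<in>{1..M}. s m ` \<Gamma>)"
    and gap_pos: "0 < d"
    and gap: "\<lbrakk>m \<in> {1..M}; m' \<in> {1..M}; m \<noteq> m'; x \<in> \<Gamma>; y \<in> \<Gamma>\<rbrakk> \<Longrightarrow> d \<le> dist (s m x) (s m' y)"
begin

lemma continuous_s: "m \<in> {1..M} \<Longrightarrow> continuous_on UNIV (s m)"
proof -
  assume m: "m \<in> {1..M}"
  have "(\<rho> m)-lipschitz_on UNIV (s m)"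
    using ratio[OF m] dist_s[OF m] by (auto simp: lipschitz_on_def)
  then show ?thesis
    by (rule lipschitz_on_continuous_on)
qed

lemma measurable_s: "m \<in> {1..M} \<Longrightarrow> s m \<in> borel_measurable borel"
  by (intro borel_measurable_continuous_onI continuous_s)

lemma borel_attractor [measurable]: "\<Gamma> \<in> sets borel"
  using compact_attractor by (simp add: borel_compact)

lemma borel_cylinder: "m \<in> {1..M} \<Longrightarrow> s m ` \<Gamma> \<in> sets borel"
  using compact_attractor continuous_s
  by (meson borel_compact compact_continuous_image continuous_on_subset subset_UNIV)

lemma disjoint_cylinders:
  assumes "m \<in> {1..M}" "m' \<in> {1..M}" "m \<noteq> m'"
  shows "s m ` \<Gamma> \<inter> s m' ` \<Gamma> = {}"
proof (rule ccontr)
  assume "s m ` \<Gamma> \<inter> s m' ` \<Gamma> \<noteq> {}"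
  then obtain x y where "x \<in> \<Gamma>" "y \<in> \<Gamma>" "s m x = s m' y"
    by blast
  then show False
    using gap[OF assms, of x y] gap_pos by simp
qed

lemma cylinder_gap:
  assumes "m \<in> {1..M}" "m' \<in> {1..M}" "m \<noteq> m'" and "z \<in> s m ` \<Gamma> \<times> s m' ` \<Gamma>"
  shows "d \<le> dist (fst z) (snd z)"
proof -
  obtain x y where "x \<in> \<Gamma>" "y \<in> \<Gamma>" "z = (s m x, s m' y)"
    using assms(4) by blast
  then show ?thesis
    using gap[OF assms(1-3)] by simp
qed

end

locale self_similar_measure = separated_similarities M \<rho> s \<Gamma> d
  for M :: nat and \<rho> :: "nat \<Rightarrow> real"
    and s :: "nat \<Rightarrow> 'a::{metric_space, second_countable_topology} \<Rightarrow> 'a"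
    and \<Gamma> d +
  fixes p :: "nat \<Rightarrow> real"
    and \<mu> :: "'a measure"
  assumes weight: "m \<in> {1..M} \<Longrightarrow> 0 < p m \<and> p m < 1"
    and weight_sum: "(\<Sum>m\<in>{1..M}. p m) = 1"
    and sets_mu: "sets \<mu> = sets borel"
    and finite_mu: "finite_measure \<mu>"
    and support: "measure \<mu> (- \<Gamma>) = 0"
    and invariant: "B \<in> sets borel \<Longrightarrow> measure \<mu> B = (\<Sum>m\<in>{1..M}. p m * measure \<mu> (s m -` B))"
begin

sublocale finite_measure \<mu>
  by (rule finite_mu)

lemma AE_attractor: "AE x in \<mu>. x \<in> \<Gamma>"
proof (rule AE_I)
  show "{x \<in> space \<mu>. \<not> x \<in> \<Gamma>} \<subseteq> - \<Gamma>" by auto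
  show "emeasure \<mu> (- \<Gamma>) = 0"
    using support by (simp add: emeasure_eq_measure)
  show "- \<Gamma> \<in> sets \<mu>"
    using sets_mu borel_attractor by (metis borel_comp)
qed

text \<open>In the invariance equation for a subset of the \<open>m\<close>-th piece only the \<open>m\<close>-th summand survives: the
  preimage under any other \<open>s k\<close> misses \<open>\<Gamma>\<close>, because the pieces are disjoint, and the complement of
  \<open>\<Gamma>\<close> is a null set.\<close>

lemma measure_Int_cylinder:
  assumes m: "m \<in> {1..M}" and B: "B \<in> sets borel"
  shows "measure \<mu> (B \<inter> s m ` \<Gamma>) = p m * measure \<mu> (s m -` B)"
proof -
  have C: "B \<inter> s m ` \<Gamma> \<in> sets borel"
    using B borel_cylinder[OF m] by auto
  have vi: "s k -` D \<in> sets \<mu>" if "k \<in> {1..M}" "D \<in> sets borel" for k D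
    using measurable_sets[OF measurable_s that(2)] that(1) sets_mu by simp
  have pre: "measure \<mu> (s k -` (B \<inter> s m ` \<Gamma>)) = (if k = m then measure \<mu> (s m -` B) else 0)"
    if k: "k \<in> {1..M}" for k
  proof (cases "k = m")
    case True
    have "measure \<mu> (s m -` (B \<inter> s m ` \<Gamma>)) = measure \<mu> (s m -` B)"
    proof (rule measure_eq_AE)
      show "AE x in \<mu>. x \<in> s m -` (B \<inter> s m ` \<Gamma>) \<longleftrightarrow> x \<in> s m -` B"
        using AE_attractor by eventually_elim auto
    qed (use vi[OF m C] vi[OF m B] in \<open>simp_all del: vimage_Int\<close>)
    with True show ?thesis by simp
  next
    case False
    have "measure \<mu> (s k -` (B \<inter> s m ` \<Gamma>)) = measure \<mu> {}"
    proof (rule measure_eq_AE)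
      show "AE x in \<mu>. x \<in> s k -` (B \<inter> s m ` \<Gamma>) \<longleftrightarrow> x \<in> {}"
        using AE_attractor
        by eventually_elim (use disjoint_cylinders[OF k m False] in auto)
    qed (use vi[OF k C] in \<open>simp_all del: vimage_Int\<close>)
    with False show ?thesis by simp
  qed
  have "measure \<mu> (B \<inter> s m ` \<Gamma>) =
      (\<Sum>k\<in>{1..M}. if k = m then p m * measure \<mu> (s m -` B) else 0)"
    unfolding invariant[OF C] by (intro sum.cong refl) (simp only: pre, simp)
  then show ?thesis
    using m by simp
qed

end

section \<open>The product measure and its self-similarity\<close>

locale self_similar_pair =
  one?: self_similar_measure M \<rho> s \<Gamma> d p \<mu> + two: self_similar_measure M \<rho> s \<Gamma> d p' \<mu>'
  for M :: nat and \<rho> :: "nat \<Rightarrow> real"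
    and s :: "nat \<Rightarrow> 'a::{metric_space, second_countable_topology} \<Rightarrow> 'a"
    and \<Gamma> d p \<mu> p' \<mu>'
begin

definition \<nu> :: "('a \<times> 'a) measure" where
  "\<nu> = \<mu> \<Otimes>\<^sub>M \<mu>'"

text \<open>The critical exponent is the solution of \<open>moment t = 1\<close>.\<close>

definition moment :: "real \<Rightarrow> real" where
  "moment t = (\<Sum>m\<in>{1..M}. p m * p' m * \<rho> m powr (- t))"

sublocale pair: pair_sigma_finite \<mu> \<mu>'
  by (intro pair_sigma_finite.intro one.sigma_finite_measure_axioms two.sigma_finite_measure_axioms)

lemma sets_nu [measurable_cong]: "sets \<nu> = sets (borel \<Otimes>\<^sub>M borel)"
  unfolding \<nu>_def by (intro sets_pair_measure_cong one.sets_mu two.sets_mu)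

lemma space_nu [simp]: "space \<nu> = UNIV"
  using sets_nu by (metis sets_eq_imp_space_eq space_borel space_pair_measure UNIV_Times_UNIV)

lemma emeasure_nu_Times:
  "\<lbrakk>B \<in> sets borel; C \<in> sets borel\<rbrakk> \<Longrightarrow>
     emeasure \<nu> (B \<times> C) = ennreal (measure \<mu> B * measure \<mu>' C)"
  unfolding \<nu>_def
  by (simp add: two.emeasure_pair_measure_Times one.sets_mu two.sets_mu
      one.emeasure_eq_measure two.emeasure_eq_measure ennreal_mult')

sublocale nu: finite_measure \<nu>
proof
  have "emeasure \<nu> (UNIV \<times> UNIV) \<noteq> \<infinity>"
    by (subst emeasure_nu_Times) auto
  then show "emeasure \<nu> (space \<nu>) \<noteq> \<infinity>" by simp
qed

lemma AE_nu_attractor: "AE z in \<nu>. z \<in> \<Gamma> \<times> \<Gamma>"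
proof -
  have "AE z in \<mu> \<Otimes>\<^sub>M \<mu>'. z \<in> \<Gamma> \<times> \<Gamma>"
  proof (rule pair.AE_pair_measure)
    have [measurable]: "\<Gamma> \<in> sets \<mu>" "\<Gamma> \<in> sets \<mu>'"
      using one.sets_mu two.sets_mu borel_attractor by auto
    show "{x \<in> space (\<mu> \<Otimes>\<^sub>M \<mu>'). x \<in> \<Gamma> \<times> \<Gamma>} \<in> sets (\<mu> \<Otimes>\<^sub>M \<mu>')"
      by measurable
    show "AE x in \<mu>. AE y in \<mu>'. (x, y) \<in> \<Gamma> \<times> \<Gamma>"
      using one.AE_attractor
    proof eventually_elim
      case (elim x)
      from two.AE_attractor show ?case
        by eventually_elim (use elim in auto)
    qed
  qed
  then show ?thesis by (simp only: \<nu>_def)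
qed

lemma borel_cylinder_Times:
  "\<lbrakk>m \<in> {1..M}; m' \<in> {1..M}\<rbrakk> \<Longrightarrow> s m ` \<Gamma> \<times> s m' ` \<Gamma> \<in> sets \<nu>"
  unfolding sets_nu using borel_cylinder by auto

text \<open>The product form of \<open>measure_Int_cylinder\<close>, as an equation between measures so that it applies to
  integrals. Both sides agree on rectangles by \<open>measure_Int_cylinder\<close>, and a product of
  \<open>\<sigma>\<close>-finite measures is determined by its values on rectangles.\<close>

lemma nu_cylinder:
  assumes m: "m \<in> {1..M}" "m' \<in> {1..M}"
  shows "density \<nu> (indicator (s m ` \<Gamma> \<times> s m' ` \<Gamma>)) =
    density (distr \<nu> (borel \<Otimes>\<^sub>M borel) (map_prod (s m) (s m'))) (\<lambda>_. ennreal (p m * p' m'))"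
proof -
  have ms [measurable]: "s m \<in> borel_measurable borel" "s m' \<in> borel_measurable borel"
    using measurable_s m by auto
  have cyl: "s m ` \<Gamma> \<in> sets borel" "s m' ` \<Gamma> \<in> sets borel"
    using borel_cylinder m by auto
  have mp [measurable]: "map_prod (s m) (s m') \<in> \<nu> \<rightarrow>\<^sub>M borel \<Otimes>\<^sub>M borel"
    unfolding map_prod_def by measurable
  \<comment> \<open>Both sides are shown to be the product of the restrictions of the two factors to their pieces.\<close>
  let ?M1 = "density \<mu> (indicator (s m ` \<Gamma>))" and ?M2 = "density \<mu>' (indicator (s m' ` \<Gamma>))"
  have e1: "emeasure ?M1 B = ennreal (measure \<mu> (B \<inter> s m ` \<Gamma>))" if "B \<in> sets borel" for B
    using that cyl
    by (simp add: emeasure_restricted one.sets_mu one.emeasure_eq_measure Int_commute)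
  have e2: "emeasure ?M2 B = ennreal (measure \<mu>' (B \<inter> s m' ` \<Gamma>))" if "B \<in> sets borel" for B
    using that cyl
    by (simp add: emeasure_restricted two.sets_mu two.emeasure_eq_measure Int_commute)
  have fin: "sigma_finite_measure ?M1" "sigma_finite_measure ?M2"
    using e1[of UNIV] e2[of UNIV] sets_eq_imp_space_eq[OF one.sets_mu]
      sets_eq_imp_space_eq[OF two.sets_mu]
    by (auto intro!: finite_measure.axioms(1) finite_measureI)
  have S: "sets (?M1 \<Otimes>\<^sub>M ?M2) = sets (borel \<Otimes>\<^sub>M borel)"
    by (intro sets_pair_measure_cong) (simp_all add: one.sets_mu two.sets_mu)
  have "?M1 \<Otimes>\<^sub>M ?M2 = density \<nu> (indicator (s m ` \<Gamma> \<times> s m' ` \<Gamma>))"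
  proof (rule pair_measure_eqI[OF fin])
    fix B C assume "B \<in> sets ?M1" "C \<in> sets ?M2"
    then have BC: "B \<in> sets borel" "C \<in> sets borel"
      by (auto simp: one.sets_mu two.sets_mu)
    have "emeasure (density \<nu> (indicator (s m ` \<Gamma> \<times> s m' ` \<Gamma>))) (B \<times> C)
        = emeasure \<nu> ((B \<times> C) \<inter> (s m ` \<Gamma> \<times> s m' ` \<Gamma>))"
      using BC cyl
      by (subst emeasure_restricted) (auto simp: sets_nu Int_commute)
    also have "\<dots> = emeasure \<nu> ((B \<inter> s m ` \<Gamma>) \<times> (C \<inter> s m' ` \<Gamma>))"
      by (simp add: Times_Int_Times)
    finally show "emeasure ?M1 B * emeasure ?M2 C =
        emeasure (density \<nu> (indicator (s m ` \<Gamma> \<times> s m' ` \<Gamma>))) (B \<times> C)"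
      using BC cyl by (simp add: e1 e2 emeasure_nu_Times ennreal_mult'')
  qed (simp only: S sets_density sets_nu)
  moreover have "?M1 \<Otimes>\<^sub>M ?M2 =
    density (distr \<nu> (borel \<Otimes>\<^sub>M borel) (map_prod (s m) (s m'))) (\<lambda>_. ennreal (p m * p' m'))"
  proof (rule pair_measure_eqI[OF fin])
    fix B C assume "B \<in> sets ?M1" "C \<in> sets ?M2"
    then have BC [measurable]: "B \<in> sets borel" "C \<in> sets borel"
      by (auto simp: one.sets_mu two.sets_mu)
    have pre: "s m -` B \<in> sets borel" "s m' -` C \<in> sets borel"
      using measurable_sets[OF ms(1) BC(1)] measurable_sets[OF ms(2) BC(2)] by auto
    have "emeasure (density (distr \<nu> (borel \<Otimes>\<^sub>M borel) (map_prod (s m) (s m')))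
          (\<lambda>_. ennreal (p m * p' m'))) (B \<times> C)
        = ennreal (p m * p' m') * emeasure \<nu> (s m -` B \<times> s m' -` C)"
      by (subst emeasure_density_const)
        (auto simp: emeasure_distr mp intro!: arg_cong2[where f = "(*)"] arg_cong2[where f = emeasure])
    then show "emeasure ?M1 B * emeasure ?M2 C = emeasure (density (distr \<nu> (borel \<Otimes>\<^sub>M borel)
          (map_prod (s m) (s m'))) (\<lambda>_. ennreal (p m * p' m'))) (B \<times> C)"
      using one.weight[OF m(1)] two.weight[OF m(2)]
      by (simp add: e1 e2 BC pre emeasure_nu_Times one.measure_Int_cylinder[OF m(1)]
          two.measure_Int_cylinder[OF m(2)] flip: ennreal_mult'')
  qed (simp only: S sets_density sets_distr)
  ultimately show ?thesis by simp
qed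

text \<open>Substitution rule: it pulls an integral over a pair of pieces back to the whole of \<open>\<Gamma> \<times> \<Gamma>\<close>, where
  it can be compared with the original energy.\<close>

lemma integral_cylinder:
  fixes g :: "'a \<times> 'a \<Rightarrow> real"
  assumes m: "m \<in> {1..M}" "m' \<in> {1..M}" and g: "g \<in> borel_measurable (borel \<Otimes>\<^sub>M borel)"
  shows "(LINT z:s m ` \<Gamma> \<times> s m' ` \<Gamma>|\<nu>. g z) =
    p m * p' m' * (LINT z|\<nu>. g (s m (fst z), s m' (snd z)))"
proof -
  have [measurable]: "s m \<in> borel_measurable borel" "s m' \<in> borel_measurable borel"
    using measurable_s m by auto
  have mp [measurable]: "map_prod (s m) (s m') \<in> \<nu> \<rightarrow>\<^sub>M borel \<Otimes>\<^sub>M borel"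
    unfolding map_prod_def by measurable
  have gn: "g \<in> borel_measurable \<nu>"
    using g by (simp cong: measurable_cong_sets add: sets_nu)
  have "(LINT z:s m ` \<Gamma> \<times> s m' ` \<Gamma>|\<nu>. g z) =
      integral\<^sup>L (density \<nu> (\<lambda>z. ennreal (indicator (s m ` \<Gamma> \<times> s m' ` \<Gamma>) z))) g"
    unfolding set_lebesgue_integral_def
    using gn borel_cylinder_Times[OF m] by (subst integral_density) auto
  also have "(\<lambda>z. ennreal (indicator (s m ` \<Gamma> \<times> s m' ` \<Gamma>) z)) = indicator (s m ` \<Gamma> \<times> s m' ` \<Gamma>)"
    by (auto simp: indicator_def fun_eq_iff)
  also have "integral\<^sup>L (density \<nu> (indicator (s m ` \<Gamma> \<times> s m' ` \<Gamma>))) g =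
      p m * p' m' * (LINT z|distr \<nu> (borel \<Otimes>\<^sub>M borel) (map_prod (s m) (s m')). g z)"
    unfolding nu_cylinder[OF m] using one.weight[OF m(1)] two.weight[OF m(2)] g
    by (subst integral_density) auto
  also have "(LINT z|distr \<nu> (borel \<Otimes>\<^sub>M borel) (map_prod (s m) (s m')). g z) =
      (LINT z|\<nu>. g (s m (fst z), s m' (snd z)))"
    using g by (subst integral_distr[OF mp]) (auto simp: map_prod_def case_prod_unfold)
  finally show ?thesis .
qed

lemma integral_attractor:
  fixes g :: "'a \<times> 'a \<Rightarrow> real"
  assumes g: "integrable \<nu> g"
  shows "(LINT z:\<Gamma> \<times> \<Gamma>|\<nu>. g z) = (LINT z|\<nu>. g z)"
  unfolding set_lebesgue_integral_def
proof (rule integral_cong_AE)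
  have [measurable]: "g \<in> borel_measurable \<nu>" "\<Gamma> \<times> \<Gamma> \<in> sets \<nu>"
    using g borel_attractor by (auto simp: sets_nu)
  show "g \<in> borel_measurable \<nu>" "(\<lambda>z. indicator (\<Gamma> \<times> \<Gamma>) z *\<^sub>R g z) \<in> borel_measurable \<nu>"
    by measurable
  show "AE z in \<nu>. indicator (\<Gamma> \<times> \<Gamma>) z *\<^sub>R g z = g z"
    using AE_nu_attractor by eventually_elim simp
qed

lemma measure_nu_UNIV: "measure \<nu> UNIV = measure \<mu> \<Gamma> * measure \<mu>' \<Gamma>"
proof -
  have "measure \<nu> UNIV = measure \<nu> (\<Gamma> \<times> \<Gamma>)"
  proof (rule measure_eq_AE)
    show "AE z in \<nu>. z \<in> UNIV \<longleftrightarrow> z \<in> \<Gamma> \<times> \<Gamma>"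
      using AE_nu_attractor by eventually_elim simp
    show "UNIV \<in> sets \<nu>" "\<Gamma> \<times> \<Gamma> \<in> sets \<nu>"
      using sets.top[of \<nu>] borel_attractor by (auto simp: sets_nu)
  qed
  then show ?thesis
    using emeasure_nu_Times[OF borel_attractor borel_attractor] by (simp add: measure_def)
qed

lemma integral_decomposition:
  fixes g :: "'a \<times> 'a \<Rightarrow> real"
  assumes g: "integrable \<nu> g"
  shows "(LINT z|\<nu>. g z) = (\<Sum>m\<in>{1..M}. LINT z:s m ` \<Gamma> \<times> s m ` \<Gamma>|\<nu>. g z) +
    (\<Sum>m\<in>{1..M}. \<Sum>m'\<in>{1..M} - {m}. LINT z:s m ` \<Gamma> \<times> s m' ` \<Gamma>|\<nu>. g z)"
proof -
  let ?C = "\<lambda>q. s (fst q) ` \<Gamma> \<times> s (snd q) ` \<Gamma>" and ?I = "{1..M} \<times> {1..M}"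
  have sub: "set_integrable \<nu> (?C q) g" if "q \<in> ?I" for q
    unfolding set_integrable_def
    using borel_cylinder_Times[of "fst q" "snd q"] that g
    by (intro integrable_mult_indicator) auto
  have un: "(\<Union>q\<in>?I. ?C q) = \<Gamma> \<times> \<Gamma>"
  proof -
    have "(\<Union>q\<in>?I. ?C q) = (\<Union>m\<in>{1..M}. s m ` \<Gamma>) \<times> (\<Union>m\<in>{1..M}. s m ` \<Gamma>)"
      by auto
    then show ?thesis
      by (simp only: attractor[symmetric])
  qed
  have "(LINT z|\<nu>. g z) = (LINT z:\<Gamma> \<times> \<Gamma>|\<nu>. g z)"
    by (rule integral_attractor[OF g, symmetric])
  also have "\<dots> = (\<Sum>q\<in>?I. LINT z:?C q|\<nu>. g z)"
  proof (subst un[symmetric], rule set_integral_finite_Union)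
    show "disjoint_family_on ?C ?I"
      unfolding disjoint_family_on_def
    proof (intro ballI impI)
      fix q r assume "q \<in> ?I" "r \<in> ?I" "q \<noteq> r"
      then have "s (fst q) ` \<Gamma> \<inter> s (fst r) ` \<Gamma> = {} \<or> s (snd q) ` \<Gamma> \<inter> s (snd r) ` \<Gamma> = {}"
        by (metis disjoint_cylinders mem_Times_iff prod_eqI)
      then show "?C q \<inter> ?C r = {}" by blast
    qed
    show "?C q \<in> sets \<nu>" if "q \<in> ?I" for q
      using borel_cylinder_Times[of "fst q" "snd q"] that by auto
  qed (use sub in auto)
  also have "\<dots> = (\<Sum>m\<in>{1..M}. \<Sum>m'\<in>{1..M}. LINT z:s m ` \<Gamma> \<times> s m' ` \<Gamma>|\<nu>. g z)"
    by (simp only: sum.cartesian_product case_prod_unfold)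
  also have "\<dots> = (\<Sum>m\<in>{1..M}. (LINT z:s m ` \<Gamma> \<times> s m ` \<Gamma>|\<nu>. g z) +
      (\<Sum>m'\<in>{1..M} - {m}. LINT z:s m ` \<Gamma> \<times> s m' ` \<Gamma>|\<nu>. g z))"
    by (intro sum.cong refl sum.remove) auto
  finally show ?thesis by (simp only: sum.distrib)
qed

section \<open>The critical exponent\<close>

lemma moment_strict_mono:
  assumes "a < b"
  shows "moment a < moment b"
  unfolding moment_def
proof (rule sum_strict_mono)
  show "{1..M} \<noteq> {}"
    using one.weight_sum by fastforce
  fix m assume m: "m \<in> {1..M}"
  have "\<rho> m powr (- a) < \<rho> m powr (- b)"
    using ratio[OF m] assms by (intro powr_less_mono') auto
  then show "p m * p' m * \<rho> m powr (- a) < p m * p' m * \<rho> m powr (- b)"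
    using one.weight[OF m] two.weight[OF m] by simp
qed simp

lemma moment_zero: "moment 0 = (\<Sum>m\<in>{1..M}. p m * p' m)"
proof -
  have "\<rho> m powr (- 0) = 1" if "m \<in> {1..M}" for m
    using ratio[OF that] by simp
  then show ?thesis
    unfolding moment_def by (intro sum.cong refl) (simp only: mult_1_right)
qed

lemma moment_zero_less_one: "moment 0 < 1"
proof -
  have "(\<Sum>m\<in>{1..M}. p m * p' m) < (\<Sum>m\<in>{1..M}. p m)"
  proof (rule sum_strict_mono)
    show "{1..M} \<noteq> {}"
      using one.weight_sum by fastforce
  qed (use one.weight two.weight in auto)
  then show ?thesis
    by (simp only: moment_zero one.weight_sum)
qed

lemma critical_exponent_exists: "\<exists>t>0. moment t = 1"
proof -
  obtain m where m: "m \<in> {1..M}"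
    using one.weight_sum by fastforce
  \<comment> \<open>At this exponent a single summand of the moment already equals 1, so the moment is at least 1.\<close>
  define T where "T = ln (p m * p' m) / ln (\<rho> m)"
  have pp: "0 < p m * p' m" "p m * p' m < 1"
    using one.weight[OF m] two.weight[OF m] mult_strict_mono[of "p m" 1 "p' m" 1] by auto
  have lr: "ln (\<rho> m) < 0"
    using ratio[OF m] by simp
  have T: "0 < T"
    using pp lr by (simp add: T_def divide_neg_neg)
  have "\<rho> m powr (- T) = inverse (p m * p' m)"
    using ratio[OF m] lr pp by (simp add: powr_def T_def exp_minus)
  then have "1 = p m * p' m * \<rho> m powr (- T)"
    using pp by (metis less_irrefl right_inverse)
  also have "\<dots> \<le> moment T"
    unfolding moment_def using m one.weight two.weight
    by (intro member_le_sum) (auto simp: less_imp_le)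
  finally have "1 \<le> moment T" .
  moreover have "continuous_on {0..T} moment"
    unfolding moment_def using ratio by (intro continuous_on_sum continuous_intros ballI) (metis less_irrefl)
  ultimately obtain t where "0 \<le> t" "moment t = 1"
    using IVT'[of moment 0 1 T] moment_zero_less_one T by auto
  then show ?thesis
    using moment_zero_less_one by (metis less_irrefl order_le_less)
qed

section \<open>Kernels that depend on the distance\<close>

text \<open>The part of the energy that comes from pairs of different pieces; there the distance is at
  least \<open>d\<close>, so these integrals are regular.\<close>

definition cross_energy :: "(real \<Rightarrow> real) \<Rightarrow> real" where
  "cross_energy h = (\<Sum>m\<in>{1..M}. \<Sum>m'\<in>{1..M} - {m}.
     LINT z:s m ` \<Gamma> \<times> s m' ` \<Gamma>|\<nu>. h (dist (fst z) (snd z)))"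

lemma measurable_radial [measurable]:
  assumes h: "h \<in> borel_measurable borel"
  shows "(\<lambda>z::'a \<times> 'a. h (dist (fst z) (snd z))) \<in> borel_measurable (borel \<Otimes>\<^sub>M borel)"
  by (intro measurable_compose[OF _ h] borel_measurable_dist measurable_fst measurable_snd)

lemma measurable_radial_nu:
  "h \<in> borel_measurable borel \<Longrightarrow> (\<lambda>z. h (dist (fst z) (snd z))) \<in> borel_measurable \<nu>"
  using measurable_radial by (simp cong: measurable_cong_sets add: sets_nu)

text \<open>Pairs in the same piece are pulled back by \<open>s m\<close> in both variables, which multiplies their distance
  by \<open>\<rho> m\<close>; the remaining pairs form the cross energy.\<close>

lemma radial_self_similarity:
  assumes h: "h \<in> borel_measurable borel"
    and int: "integrable \<nu> (\<lambda>z. h (dist (fst z) (snd z)))"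
  shows "(LINT z|\<nu>. h (dist (fst z) (snd z))) =
    (\<Sum>m\<in>{1..M}. p m * p' m * (LINT z|\<nu>. h (\<rho> m * dist (fst z) (snd z)))) + cross_energy h"
proof -
  have "(LINT z:s m ` \<Gamma> \<times> s m ` \<Gamma>|\<nu>. h (dist (fst z) (snd z))) =
      p m * p' m * (LINT z|\<nu>. h (\<rho> m * dist (fst z) (snd z)))" if "m \<in> {1..M}" for m
    by (subst integral_cylinder[OF that that measurable_radial[OF h]]) (simp add: dist_s[OF that])
  then show ?thesis
    by (subst integral_decomposition[OF int]) (simp add: cross_energy_def)
qed

text \<open>The indicator of \<open>{0}\<close> is a bounded kernel that is unchanged by scaling and vanishes on pairs of
  different pieces. Self-similarity therefore says that the mass of the diagonal equals
  \<open>moment 0 < 1\<close> times itself.\<close>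

lemma AE_off_diagonal: "AE z in \<nu>. fst z \<noteq> snd z"
proof -
  define h :: "real \<Rightarrow> real" where "h = indicator {0}"
  have h [measurable]: "h \<in> borel_measurable borel"
    unfolding h_def by measurable
  let ?g = "\<lambda>z. h (dist (fst z) (snd z))"
  have int: "integrable \<nu> ?g"
    by (rule nu.integrable_const_bound[where B = 1])
      (auto simp: h_def indicator_def measurable_radial_nu[OF h, unfolded h_def indicator_def])
  have "cross_energy h = 0"
    unfolding cross_energy_def
  proof (intro sum.neutral ballI)
    fix m m' assume m: "m \<in> {1..M}" "m' \<in> {1..M} - {m}"
    have vanish: "indicator (s m ` \<Gamma> \<times> s m' ` \<Gamma>) z *\<^sub>R ?g z = 0" for z
    proof (cases "z \<in> s m ` \<Gamma> \<times> s m' ` \<Gamma>")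
      case True
      then have "d \<le> dist (fst z) (snd z)"
        using cylinder_gap m by (metis DiffD1 DiffD2 singletonI)
      then show ?thesis
        using gap_pos by (auto simp: h_def indicator_def)
    qed simp
    show "(LINT z:s m ` \<Gamma> \<times> s m' ` \<Gamma>|\<nu>. ?g z) = 0"
      unfolding set_lebesgue_integral_def by (simp only: vanish integral_zero)
  qed
  moreover have "h (\<rho> m * r) = h r" if "m \<in> {1..M}" for m r
    using ratio[OF that] by (auto simp: h_def indicator_def)
  ultimately have "(LINT z|\<nu>. ?g z) = moment 0 * (LINT z|\<nu>. ?g z)"
    by (subst radial_self_similarity[OF h int]) (simp add: moment_zero sum_distrib_right)
  then have "(LINT z|\<nu>. ?g z) = 0"
    using moment_zero_less_one by auto
  then have "AE z in \<nu>. ?g z = 0"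
    by (subst (asm) integral_nonneg_eq_0_iff_AE[OF int]) (auto simp: h_def)
  then show ?thesis
    by eventually_elim (auto simp: h_def)
qed

section \<open>Convergence of the energies\<close>

text \<open>Truncating the distance at \<open>e\<close> makes the energy finite beforehand, so that it can be subtracted from
  both sides of an inequality. The truncation \<open>max r e\<close> is chosen because it satisfies
  \<open>\<rho> * max r e \<le> max (\<rho> * r) e\<close> for \<open>\<rho> < 1\<close>: the truncated kernel grows under a contraction by at most
  the factor \<open>\<rho> powr (- t)\<close> of the full kernel. The bound does not involve \<open>e\<close>.\<close>

lemma truncated_energy_bound:
  assumes t: "0 \<le> t" "moment t < 1" and e: "0 < e"
  defines "h \<equiv> \<lambda>r. max r e powr (- t)"
  shows "integrable \<nu> (\<lambda>z. h (dist (fst z) (snd z)))"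
    and "(LINT z|\<nu>. h (dist (fst z) (snd z))) \<le>
      (\<Sum>m\<in>{1..M}. \<Sum>m'\<in>{1..M} - {m}. d powr (- t) * measure \<nu> UNIV) / (1 - moment t)"
proof -
  have h [measurable]: "h \<in> borel_measurable borel"
    unfolding h_def by measurable
  have bnd: "\<bar>h r\<bar> \<le> e powr (- t)" for r
    using e t by (auto simp: h_def intro!: powr_mono2')
  have ints: "integrable \<nu> (\<lambda>z. h (c * dist (fst z) (snd z)))" for c
    by (rule nu.integrable_const_bound[where B = "e powr (- t)"])
      (use bnd measurable_radial_nu[of "\<lambda>r. h (c * r)"] in auto)
  from ints[of 1] show int: "integrable \<nu> (\<lambda>z. h (dist (fst z) (snd z)))"
    by simp
  let ?I = "LINT z|\<nu>. h (dist (fst z) (snd z))"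
  have near: "p m * p' m * (LINT z|\<nu>. h (\<rho> m * dist (fst z) (snd z))) \<le>
      p m * p' m * \<rho> m powr (- t) * ?I" if m: "m \<in> {1..M}" for m
  proof -
    have "h (\<rho> m * r) \<le> \<rho> m powr (- t) * h r" if "0 \<le> r" for r
    proof -
      have "\<rho> m * e \<le> e"
        using ratio[OF m] e by simp
      then have "\<rho> m * max r e \<le> max (\<rho> m * r) e"
        using ratio[OF m] by (simp add: max_mult_distrib_left max.coboundedI2)
      then have "h (\<rho> m * r) \<le> (\<rho> m * max r e) powr (- t)"
        unfolding h_def using ratio[OF m] e t by (intro powr_mono2') auto
      also have "\<dots> = \<rho> m powr (- t) * h r"
        unfolding h_def using ratio[OF m] e by (intro powr_mult)
      finally show ?thesis .
    qed
    then have "(LINT z|\<nu>. h (\<rho> m * dist (fst z) (snd z))) \<le>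
        (LINT z|\<nu>. \<rho> m powr (- t) * h (dist (fst z) (snd z)))"
      using ints int by (intro integral_mono) auto
    then show ?thesis
      using one.weight[OF m] two.weight[OF m] by (simp add: mult.assoc)
  qed
  have far: "cross_energy h \<le> (\<Sum>m\<in>{1..M}. \<Sum>m'\<in>{1..M} - {m}. d powr (- t) * measure \<nu> UNIV)"
    unfolding cross_energy_def
  proof (intro sum_mono)
    fix m m' assume m: "m \<in> {1..M}" "m' \<in> {1..M} - {m}"
    let ?C = "s m ` \<Gamma> \<times> s m' ` \<Gamma>"
    have "(LINT z:?C|\<nu>. h (dist (fst z) (snd z))) \<le> (LINT z|\<nu>. d powr (- t))"
      unfolding set_lebesgue_integral_def
    proof (rule integral_mono)
      show "integrable \<nu> (\<lambda>z. indicator ?C z *\<^sub>R h (dist (fst z) (snd z)))"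
        using m int by (intro integrable_mult_indicator borel_cylinder_Times) auto
      show "indicator ?C z *\<^sub>R h (dist (fst z) (snd z)) \<le> d powr (- t)" for z
      proof (cases "z \<in> ?C")
        case True
        then have "d \<le> dist (fst z) (snd z)"
          using cylinder_gap m by (metis DiffD1 DiffD2 singletonI)
        then have "h (dist (fst z) (snd z)) \<le> d powr (- t)"
          unfolding h_def using gap_pos t by (intro powr_mono2') auto
        with True show ?thesis by simp
      qed simp
    qed simp
    then show "(LINT z:?C|\<nu>. h (dist (fst z) (snd z))) \<le> d powr (- t) * measure \<nu> UNIV"
      by (simp add: mult.commute)
  qed
  have "?I \<le> (\<Sum>m\<in>{1..M}. p m * p' m * \<rho> m powr (- t) * ?I) +
      (\<Sum>m\<in>{1..M}. \<Sum>m'\<in>{1..M} - {m}. d powr (- t) * measure \<nu> UNIV)"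
    by (subst radial_self_similarity[OF h int]) (intro add_mono sum_mono near far)
  then have "?I \<le> moment t * ?I + (\<Sum>m\<in>{1..M}. \<Sum>m'\<in>{1..M} - {m}. d powr (- t) * measure \<nu> UNIV)"
    by (simp only: moment_def sum_distrib_right)
  then show "?I \<le> (\<Sum>m\<in>{1..M}. \<Sum>m'\<in>{1..M} - {m}. d powr (- t) * measure \<nu> UNIV) / (1 - moment t)"
    by (rule solve_affine_le) (rule t)
qed

text \<open>Monotone convergence along truncations at \<open>1 / (i + 1)\<close>. On the diagonal, a null
  set, convergence fails: the truncated kernels are at least \<open>1\<close> there, whereas \<open>0 powr (- t) = 0\<close>.\<close>

lemma integrable_riesz:
  assumes t: "0 \<le> t" "moment t < 1"
  shows "integrable \<nu> (\<lambda>z. dist (fst z) (snd z) powr (- t))"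
proof -
  define f where "f i z = max (dist (fst z) (snd z)) (inverse (real (Suc i))) powr (- t)"
    for i and z :: "'a \<times> 'a"
  note trunc = truncated_energy_bound[OF t, of "inverse (real (Suc i))" for i, folded f_def]
  have step: "f i z \<le> f (Suc i) z" for i z
  proof -
    have "inverse (real (Suc (Suc i))) \<le> inverse (real (Suc i))" "0 < inverse (real (Suc (Suc i)))"
      by (intro le_imp_inverse_le) simp_all
    then show ?thesis
      unfolding f_def using t by (intro powr_mono2' max.mono order_refl) (simp_all add: less_max_iff_disj del: of_nat_Suc)
  qed
  have mono: "incseq (\<lambda>i. f i z)" for z
    by (rule incseq_SucI) (rule step)
  have "incseq (\<lambda>i. LINT z|\<nu>. f i z)"
    using trunc(1) step by (intro incseq_SucI integral_mono) auto
  moreover have "bdd_above (range (\<lambda>i. LINT z|\<nu>. f i z))"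
    using trunc(2) by (intro bdd_aboveI2) auto
  ultimately have "(\<lambda>i. LINT z|\<nu>. f i z) \<longlonglongrightarrow> (SUP i. LINT z|\<nu>. f i z)"
    by (intro LIMSEQ_incseq_SUP)
  moreover have "AE z in \<nu>. (\<lambda>i. f i z) \<longlonglongrightarrow> dist (fst z) (snd z) powr (- t)"
    using AE_off_diagonal
  proof eventually_elim
    case (elim z)
    have "(\<lambda>i. max (dist (fst z) (snd z)) (inverse (real (Suc i)))) \<longlonglongrightarrow> max (dist (fst z) (snd z)) 0"
      by (intro tendsto_max tendsto_const LIMSEQ_inverse_real_of_nat)
    then show ?case
      unfolding f_def using elim by (intro tendsto_powr tendsto_const) auto
  qed
  ultimately show ?thesis
    using mono measurable_radial_nu[of "\<lambda>r. r powr (- t)"]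
    by (intro integrable_monotone_convergence[where f = f, OF trunc(1)]) simp_all
qed

text \<open>Near the diagonal \<open>- ln r\<close> is at most \<open>r powr (- t) / t\<close> for any \<open>t > 0\<close>, and half the critical
  exponent makes the right-hand side integrable; away from it \<open>ln r\<close> is bounded by the diameter of
  \<open>\<Gamma>\<close>.\<close>

lemma integrable_log: "integrable \<nu> (\<lambda>z. ln (dist (fst z) (snd z)))"
proof -
  obtain T where T: "0 < T" "moment T = 1"
    using critical_exponent_exists by blast
  define t where "t = T / 2"
  have t: "0 < t" "moment t < 1"
    using T moment_strict_mono[of t T] by (auto simp: t_def)
  have "integrable \<nu> (\<lambda>z. dist (fst z) (snd z) powr (- t) / t + diameter \<Gamma>)"
    using integrable_riesz[of t] t by (intro Bochner_Integration.integrable_add integrable_divide) simp_all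
  then show ?thesis
  proof (rule Bochner_Integration.integrable_bound)
    show "(\<lambda>z. ln (dist (fst z) (snd z))) \<in> borel_measurable \<nu>"
      by (rule measurable_radial_nu[where h = ln]) measurable
    show "AE z in \<nu>. norm (ln (dist (fst z) (snd z)))
        \<le> norm (dist (fst z) (snd z) powr (- t) / t + diameter \<Gamma>)"
      using AE_off_diagonal AE_nu_attractor
    proof eventually_elim
      case (elim z)
      define r where "r = dist (fst z) (snd z)"
      have mem: "fst z \<in> \<Gamma>" "snd z \<in> \<Gamma>"
        using elim by (simp_all add: mem_Times_iff)
      have r: "0 < r" "r \<le> diameter \<Gamma>"
        using elim diameter_bounded_bound[OF compact_imp_bounded[OF compact_attractor] mem]
        by (simp_all add: r_def)
      \<comment> \<open>The left-hand side is the logarithm of the right-hand side.\<close>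
      have "- (t * ln r) \<le> r powr (- t)"
        using ln_le_minus_one[of "r powr (- t)"] r by (simp add: ln_powr)
      then have "- ln r \<le> r powr (- t) / t"
        using t by (simp add: pos_le_divide_eq mult.commute)
      moreover have "ln r \<le> diameter \<Gamma>"
        using ln_le_minus_one[of r] r by simp
      moreover have "0 \<le> r powr (- t) / t" "0 \<le> diameter \<Gamma>"
        using t r by auto
      ultimately have "\<bar>ln r\<bar> \<le> r powr (- t) / t + diameter \<Gamma>"
        by linarith
      then show ?case
        by (simp add: r_def)
    qed
  qed
qed

section \<open>Evaluation of the energies\<close>

lemma riesz_energy:
  assumes t: "0 \<le> t" "moment t < 1"
  shows "(LINT z|\<nu>. dist (fst z) (snd z) powr (- t)) = inverse (1 - moment t) * cross_energy (\<lambda>r. r powr (- t))"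
proof -
  let ?I = "LINT z|\<nu>. dist (fst z) (snd z) powr (- t)"
  have "?I = (\<Sum>m\<in>{1..M}. p m * p' m * (LINT z|\<nu>. (\<rho> m * dist (fst z) (snd z)) powr (- t)))
      + cross_energy (\<lambda>r. r powr (- t))"
    by (rule radial_self_similarity[where h = "\<lambda>r. r powr (- t)", OF _ integrable_riesz[OF t]]) measurable
  also have "(\<Sum>m\<in>{1..M}. p m * p' m * (LINT z|\<nu>. (\<rho> m * dist (fst z) (snd z)) powr (- t))) =
      moment t * ?I"
    unfolding moment_def sum_distrib_right
  proof (intro sum.cong refl)
    fix m assume "m \<in> {1..M}"
    then show "p m * p' m * (LINT z|\<nu>. (\<rho> m * dist (fst z) (snd z)) powr (- t)) =
        p m * p' m * \<rho> m powr (- t) * ?I"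
      using ratio[of m] by (simp add: powr_mult)
  qed
  finally show ?thesis
    by (rule solve_affine) (rule t)
qed

text \<open>\<open>ln (\<rho> m * r) = ln (\<rho> m) + ln r\<close> holds off the diagonal, where \<open>r > 0\<close>, so scaling adds a constant
  to the kernel instead of a factor; integrating the constants over \<open>\<nu>\<close> gives the additional sum.\<close>

lemma log_energy:
  "(LINT z|\<nu>. ln (dist (fst z) (snd z))) = inverse (1 - moment 0) *
    ((\<Sum>m\<in>{1..M}. p m * p' m * measure \<nu> UNIV * ln (\<rho> m)) + cross_energy ln)"
proof -
  let ?I = "LINT z|\<nu>. ln (dist (fst z) (snd z))"
  have scale: "(LINT z|\<nu>. ln (\<rho> m * dist (fst z) (snd z))) = measure \<nu> UNIV * ln (\<rho> m) + ?I"
    if m: "m \<in> {1..M}" for m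
  proof -
    have "(LINT z|\<nu>. ln (\<rho> m * dist (fst z) (snd z))) =
        (LINT z|\<nu>. ln (\<rho> m) + ln (dist (fst z) (snd z)))"
    proof (rule integral_cong_AE)
      show "AE z in \<nu>. ln (\<rho> m * dist (fst z) (snd z)) = ln (\<rho> m) + ln (dist (fst z) (snd z))"
        using AE_off_diagonal by eventually_elim (use ratio[OF m] in \<open>auto simp: ln_mult\<close>)
    qed (use measurable_radial_nu[of "\<lambda>r. ln (\<rho> m * r)"] measurable_radial_nu[of "\<lambda>r. ln (\<rho> m) + ln r"]
        in \<open>simp_all\<close>)
    also have "\<dots> = measure \<nu> UNIV * ln (\<rho> m) + ?I"
      using integrable_log by simp
    finally show ?thesis .
  qed
  have "?I = (\<Sum>m\<in>{1..M}. p m * p' m * (LINT z|\<nu>. ln (\<rho> m * dist (fst z) (snd z)))) + cross_energy ln"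
    by (rule radial_self_similarity[where h = ln, OF _ integrable_log]) measurable
  also have "(\<Sum>m\<in>{1..M}. p m * p' m * (LINT z|\<nu>. ln (\<rho> m * dist (fst z) (snd z)))) =
      moment 0 * ?I + (\<Sum>m\<in>{1..M}. p m * p' m * measure \<nu> UNIV * ln (\<rho> m))"
    unfolding moment_zero sum_distrib_right sum.distrib[symmetric]
    by (intro sum.cong refl) (simp only: scale distrib_left mult.assoc add.commute)
  finally have "?I = moment 0 * ?I +
      ((\<Sum>m\<in>{1..M}. p m * p' m * measure \<nu> UNIV * ln (\<rho> m)) + cross_energy ln)"
    by (simp only: add.assoc)
  then show ?thesis
    by (rule solve_affine) (rule moment_zero_less_one)
qed

end

text \<open>Fubini: it connects the iterated integrals with integrals over the product measure, where
  self-similarity was exploited.\<close>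

lemma double_integral_eq_product_integral:
  assumes "pair_sigma_finite \<mu> \<mu>'"
    and "S \<in> sets \<mu>" "T \<in> sets \<mu>'"
    and int: "integrable (\<mu> \<Otimes>\<^sub>M \<mu>') (\<lambda>z. f (fst z) (snd z))"
  shows "double_integral \<mu> \<mu>' S T f = (LINT z:S \<times> T|(\<mu> \<Otimes>\<^sub>M \<mu>'). f (fst z) (snd z))"
proof -
  interpret pair_sigma_finite \<mu> \<mu>' by fact
  have "integrable (\<mu> \<Otimes>\<^sub>M \<mu>') (\<lambda>z. indicator (S \<times> T) z *\<^sub>R f (fst z) (snd z))"
    using assms by (intro integrable_mult_indicator) auto
  then have "(LINT x|\<mu>. LINT y|\<mu>'. indicator (S \<times> T) (x, y) *\<^sub>R f x y) =
      (LINT z|(\<mu> \<Otimes>\<^sub>M \<mu>'). indicator (S \<times> T) z *\<^sub>R f (fst z) (snd z))"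
    by (subst integral_fst'[symmetric]) simp_all
  then show ?thesis
    unfolding double_integral_def set_lebesgue_integral_def
    by (simp add: indicator_times mult.assoc)
qed

theorem theorem4p6:
  fixes M :: nat
    and \<rho> :: "nat \<Rightarrow> real"
    and A :: "nat \<Rightarrow> real^'n^'n"
    and \<delta> :: "nat \<Rightarrow> real^'n"
    and s :: "nat \<Rightarrow> real^'n \<Rightarrow> real^'n"
    and \<Gamma> :: "(real^'n) set"
    and p p' :: "nat \<Rightarrow> real"
    and \<mu> \<mu>' :: "(real^'n) measure"
  assumes "similarity_ifs M \<rho> A \<delta> s"
    and "open_set_condition M s"
    and "is_attractor M s \<Gamma>"
    and "ifs_weights M p" and "ifs_weights M p'"
    and "invariant_measure M s p \<Gamma> \<mu>" and "invariant_measure M s p' \<Gamma> \<mu>'"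
    and "disjoint_attractor M s \<Gamma>"
  shows "\<exists>tstar::real.
      0 < tstar \<and> (\<Sum>m\<in>{1..M}. p m * p' m * \<rho> m powr (- tstar)) = 1 \<and>
      (\<forall>u>0. (\<Sum>m\<in>{1..M}. p m * p' m * \<rho> m powr (- u)) = 1 \<longrightarrow> u = tstar) \<and>
      (\<forall>t. 0 \<le> t \<and> t < tstar \<longrightarrow>
         converges_on \<mu> \<mu>' \<Gamma> \<Gamma> (Phi t) \<and>
         double_integral \<mu> \<mu>' \<Gamma> \<Gamma> (Phi t) =
           (if t = 0 then
              inverse (1 - (\<Sum>m\<in>{1..M}. p m * p' m)) *
              (\<Sum>m\<in>{1..M}. p m * p' m * measure \<mu> \<Gamma> * measure \<mu>' \<Gamma> * ln (\<rho> m) +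
                 (\<Sum>m'\<in>{1..M} - {m}. double_integral \<mu> \<mu>' (s m ` \<Gamma>) (s m' ` \<Gamma>) (Phi t)))
            else
              inverse (1 - (\<Sum>m\<in>{1..M}. p m * p' m * \<rho> m powr (- t))) *
              (\<Sum>m\<in>{1..M}. \<Sum>m'\<in>{1..M} - {m}.
                 double_integral \<mu> \<mu>' (s m ` \<Gamma>) (s m' ` \<Gamma>) (Phi t))))"
proof -
  have ifs: "0 < \<rho> m" "\<rho> m < 1" "orthogonal_matrix (A m)" "s m x = \<rho> m *\<^sub>R (A m *v x) + \<delta> m"
    if "m \<in> {1..M}" for m x
    using assms(1) that unfolding similarity_ifs_def by auto
  define D where "D = {setdist (s m ` \<Gamma>) (s m' ` \<Gamma>) | m m'. m \<in> {1..M} \<and> m' \<in> {1..M} \<and> m \<noteq> m'}"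
  have "D \<subseteq> (\<lambda>(m, m'). setdist (s m ` \<Gamma>) (s m' ` \<Gamma>)) ` ({1..M} \<times> {1..M})"
    unfolding D_def by auto
  then have finite_D: "finite D"
    by (rule finite_subset) simp
  have "separated_similarities M \<rho> s \<Gamma> (Min D)"
  proof
    show "0 < \<rho> m \<and> \<rho> m < 1" if "m \<in> {1..M}" for m
      using ifs that by blast
    show "dist (s m x) (s m y) = \<rho> m * dist x y" if m: "m \<in> {1..M}" for m x y
    proof -
      have "s m x - s m y = \<rho> m *\<^sub>R (A m *v (x - y))"
        by (simp add: ifs(4)[OF m] matrix_vector_mult_diff_distrib scaleR_diff_right)
      moreover have "norm (A m *v (x - y)) = norm (x - y)"
        using ifs(3)[OF m]
        by (simp add: orthogonal_transformation_norm orthogonal_transformation_matrix matrix_vector_mul_linear)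
      ultimately show ?thesis
        using ifs(1)[OF m] by (simp add: dist_norm)
    qed
    show "compact \<Gamma>" "\<Gamma> = (\<Union>m\<in>{1..M}. s m ` \<Gamma>)"
      using assms(3) unfolding is_attractor_def by blast+
    show "0 < Min D"
      using assms(8) unfolding disjoint_attractor_def D_def .
    show "Min D \<le> dist (s m x) (s m' y)"
      if "m \<in> {1..M}" "m' \<in> {1..M}" "m \<noteq> m'" "x \<in> \<Gamma>" "y \<in> \<Gamma>" for m m' x y
    proof -
      have "Min D \<le> setdist (s m ` \<Gamma>) (s m' ` \<Gamma>)"
        using that by (intro Min_le[OF finite_D]) (auto simp: D_def)
      also have "\<dots> \<le> dist (s m x) (s m' y)"
        using that by (intro setdist_le_dist) auto
      finally show ?thesis .
    qed
  qed
  then interpret self_similar_pair M \<rho> s \<Gamma> "Min D" p \<mu> p' \<mu>'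
  proof (intro self_similar_pair.intro self_similar_measure.intro self_similar_measure_axioms.intro)
    show "0 < p m \<and> p m < 1" "0 < p' m \<and> p' m < 1" if "m \<in> {1..M}" for m
      using assms(4,5) that unfolding ifs_weights_def by blast+
    show "(\<Sum>m\<in>{1..M}. p m) = 1" "(\<Sum>m\<in>{1..M}. p' m) = 1"
      using assms(4,5) unfolding ifs_weights_def by blast+
    show "sets \<mu> = sets borel" "finite_measure \<mu>" "measure \<mu> (- \<Gamma>) = 0"
      "sets \<mu>' = sets borel" "finite_measure \<mu>'" "measure \<mu>' (- \<Gamma>) = 0"
      using assms(6,7) unfolding invariant_measure_def by blast+
    show "measure \<mu> B = (\<Sum>m\<in>{1..M}. p m * measure \<mu> (s m -` B))"
      "measure \<mu>' B = (\<Sum>m\<in>{1..M}. p' m * measure \<mu>' (s m -` B))" if "B \<in> sets borel" for B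
      using assms(6,7) that unfolding invariant_measure_def by blast+
  qed
  have pieces: "\<Gamma> \<in> sets \<mu>" "\<Gamma> \<in> sets \<mu>'"
    "m \<in> {1..M} \<Longrightarrow> s m ` \<Gamma> \<in> sets \<mu>" "m \<in> {1..M} \<Longrightarrow> s m ` \<Gamma> \<in> sets \<mu>'" for m
    using borel_attractor borel_cylinder by (simp_all add: one.sets_mu two.sets_mu)
  obtain T where T: "0 < T" "moment T = 1"
    using critical_exponent_exists by blast
  \<comment> \<open>One statement for both kernels: \<open>h\<close> is the logarithm or a negative power.\<close>
  have energy: "converges_on \<mu> \<mu>' \<Gamma> \<Gamma> (Phi t)"
      "double_integral \<mu> \<mu>' \<Gamma> \<Gamma> (Phi t) = (LINT z|\<nu>. h (dist (fst z) (snd z)))"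
      "(\<Sum>m\<in>{1..M}. \<Sum>m'\<in>{1..M} - {m}. double_integral \<mu> \<mu>' (s m ` \<Gamma>) (s m' ` \<Gamma>) (Phi t)) = cross_energy h"
    if Phi: "Phi t = (\<lambda>(x::real^'n) y. h (dist x y))"
      and int: "integrable \<nu> (\<lambda>z. h (dist (fst z) (snd z)))" for t h
  proof -
    have product: "double_integral \<mu> \<mu>' S S' (Phi t) = (LINT z:S \<times> S'|\<nu>. h (dist (fst z) (snd z)))"
      if "S \<in> sets \<mu>" "S' \<in> sets \<mu>'" for S S'
      using double_integral_eq_product_integral[OF pair.pair_sigma_finite_axioms that, of "Phi t"] int
      unfolding Phi \<nu>_def by simp
    show "converges_on \<mu> \<mu>' \<Gamma> \<Gamma> (Phi t)"
      unfolding converges_on_def \<nu>_def[symmetric]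
    proof
      show "AE z in \<nu>. z \<in> \<Gamma> \<times> \<Gamma> \<longrightarrow> fst z \<noteq> snd z"
        using AE_off_diagonal by eventually_elim simp
      have "\<Gamma> \<times> \<Gamma> \<in> sets \<nu>"
        unfolding \<nu>_def using pieces(1,2) by (rule pair_measureI)
      then show "set_integrable \<nu> (\<Gamma> \<times> \<Gamma>) (\<lambda>(x, y). Phi t x y)"
        unfolding set_integrable_def Phi case_prod_unfold
        using int by (rule integrable_mult_indicator)
    qed
    show "double_integral \<mu> \<mu>' \<Gamma> \<Gamma> (Phi t) = (LINT z|\<nu>. h (dist (fst z) (snd z)))"
      by (simp only: product[OF pieces(1,2)] integral_attractor[OF int])
    show "(\<Sum>m\<in>{1..M}. \<Sum>m'\<in>{1..M} - {m}. double_integral \<mu> \<mu>' (s m ` \<Gamma>) (s m' ` \<Gamma>) (Phi t)) = cross_energy h"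
      unfolding cross_energy_def by (intro sum.cong refl product pieces) auto
  qed
  show ?thesis
  proof (intro exI[of _ T] conjI allI impI)
    show "(\<Sum>m\<in>{1..M}. p m * p' m * \<rho> m powr (- T)) = 1"
      using T(2) unfolding moment_def .
    show "u = T" if "(\<Sum>m\<in>{1..M}. p m * p' m * \<rho> m powr (- u)) = 1" for u
      using that T(2) moment_strict_mono[of u T] moment_strict_mono[of T u]
      unfolding moment_def[symmetric] by (cases u T rule: linorder_cases) auto
  next
    fix t :: real assume "0 \<le> t \<and> t < T"
    then have t: "0 \<le> t" "moment t < 1"
      using moment_strict_mono[of t T] T by auto
    define h where "h = (\<lambda>r::real. if t = 0 then ln r else r powr (- t))"
    have Phi: "Phi t = (\<lambda>(x::real^'n) y. h (dist x y))"
      by (simp add: Phi_def h_def dist_norm fun_eq_iff)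
    have int: "integrable \<nu> (\<lambda>z. h (dist (fst z) (snd z)))"
      using integrable_log integrable_riesz[OF t] by (cases "t = 0") (simp_all add: h_def)
    note e = energy[OF Phi int]
    show "converges_on \<mu> \<mu>' \<Gamma> \<Gamma> (Phi t)"
      by (rule e)
    show "double_integral \<mu> \<mu>' \<Gamma> \<Gamma> (Phi t) =
           (if t = 0 then
              inverse (1 - (\<Sum>m\<in>{1..M}. p m * p' m)) *
              (\<Sum>m\<in>{1..M}. p m * p' m * measure \<mu> \<Gamma> * measure \<mu>' \<Gamma> * ln (\<rho> m) +
                 (\<Sum>m'\<in>{1..M} - {m}. double_integral \<mu> \<mu>' (s m ` \<Gamma>) (s m' ` \<Gamma>) (Phi t)))
            else
              inverse (1 - (\<Sum>m\<in>{1..M}. p m * p' m * \<rho> m powr (- t))) *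
              (\<Sum>m\<in>{1..M}. \<Sum>m'\<in>{1..M} - {m}.
                 double_integral \<mu> \<mu>' (s m ` \<Gamma>) (s m' ` \<Gamma>) (Phi t)))"
    proof (cases "t = 0")
      case True
      then have "h = ln"
        by (simp add: h_def fun_eq_iff)
      with log_energy show ?thesis
        unfolding sum.distrib e(2,3) if_P[OF True]
        by (simp only: moment_zero measure_nu_UNIV mult.assoc)
    next
      case False
      then have "h = (\<lambda>r. r powr (- t))"
        by (simp add: h_def fun_eq_iff)
      with riesz_energy[OF t] show ?thesis
        unfolding e(2,3) if_not_P[OF False] by (simp only: moment_def)
    qed
  qed (rule T)
qed

end
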